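(* Let $A$ be a set and let $\lambda$ be a strong limit cardinal (i.e. $\lambda'<\lambda$ implies $2^{\lambda'}<\lambda$) with $\lambda>|A|$. Then: (1) If $C$ is a $<\lambda$-ary operational clone on $A$, then $\mathrm{Pol}_{<\lambda}(\mathrm{Inv}_{<\lambda}(C))=C$. (2) If $R$ is a $<\lambda$-ary relational clone on $A$, then $\mathrm{Inv}_{<\lambda}(\mathrm{Pol}_{<\lambda}(R))=R$.
   Context: For a cardinal $\mu$, a $\mu$-ary operation on $A$ is a map $A^{\mu}\to A$, and a $\mu$-ary relation on $A$ is a subset of $A^{\mu}$ (tuples indexed by the ordinals below $\mu$). A $<\lambda$-ary (operational) clone on $A$ is a set $C\subseteq\bigcup_{\lambda'<\lambda}A^{A^{\lambda'}}$ such that: (i) for every cardinal $\lambda'<\lambda$ and every $i\in\lambda'$, the projection $(a_j)_{j\in\lambda'}\mapsto a_i$ belongs to $C$; (ii) whenever $\lambda'<\lambda$, $f\in C$ has arity $\lambda''$, and $g_i\in C$ are $\lambda'$-ary for $i\in\lambda''$, the composition $(a_j)_{j\in\lambda'}\mapsto f\big(g_i((a_j)_{j\in\lambda'})\big)_{i\in\lambda''}$ belongs to $C$. A $<\kappa$-ary relational clone on $A$ (for an infinite cardinal $\kappa$) is a set $R\subseteq\bigcup_{\kappa'<\kappa}\mathcal P(A^{\kappa'})$ with the following closure property: whenever $\{r_k\}_{k\in K}\subseteq R$ with $r_k\subseteq A^{\kappa_k}$, $\kappa'<\kappa$ is a cardinal, $\tilde\kappa$ is a cardinal, $U$ is a set,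 $g:U\to K$ and $f:\bigcup_{u\in U}\{u\}\times\kappa_{g(u)}\to\kappa'\sqcup\tilde\kappa$ are maps, the relation $$r=\{(a_{j'})_{j'\in\kappa'}\in A^{\kappa'}\mid \exists (a_{\tilde j})_{\tilde j\in\tilde\kappa}\ \textstyle\bigwedge_{u\in U}(a_{f(u,j)})_{j\in\kappa_{g(u)}}\in r_{g(u)}\}$$ belongs to $R$ (i.e. $R$ is closed under definitions by primitive positive formulas of infinitary logic $L_{\infty,\infty}$). For a set $F$ of operations on $A$ of arities $<\lambda$, a $\kappa$-ary relation $r$ is invariant to $F$ if for every $f\in F$ of arity $\lambda'$ and every family $(a_{ij})_{j\in\kappa}\in r$ ($i\in\lambda'$) one has $(f((a_{ij})_{i\in\lambda'}))_{j\in\kappa}\in r$. $\mathrm{Inv}_\kappa(F)$ is the set of $\kappa$-ary relations invariant to $F$, and $\mathrm{Inv}_{<\kappa}(F)=\bigcup_{\kappa'<\kappa}\mathrm{Inv}_{\kappa'}(F)$. For a set $R$ of relations on $A$ of arities $<\kappa$, a $\lambda$-ary operation $f$ is a polymorphism of $R$ if for every $r\in R$ of arity $\kappa'$ and every family $(a_{ij})_{j\in\kappa'}\in r$ ($i\in\lambda$) one has $(f((a_{ij})_{i\in\lambda}))_{j\in\kappa'}\in r$. $\mathrm{Pol}_\lambda(R)$ is the set of $\lambda$-ary polymorphisms of $R$, and $\mathrm{Pol}_{<\lambda}(R)=\bigcup_{\lambda'<\lambda}\mathrm{Pol}_{\lambda'}(R)$.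
   Formalization: Relational clones are required to be closed under primitive positive formulas that may also contain equations between variables; with the displayed equality-free closure, (2) fails for |A| ≥ 2 (take R to be all full relations A^k, k<λ). *)

theory Defs
  imports Main "HOL-Library.FuncSet"
begin

unbundle cardinal_syntax

text \<open>
  A cardinal is a relation \<open>\<kappa>\<close> with \<^term>\<open>Card_order \<kappa>\<close>; it is a well-order whose elements play the
  role of the ordinals below it, with \<open>x\<close> standing for the set \<^term>\<open>underS \<kappa> x\<close> of its predecessors.
  The cardinals below \<open>\<kappa>\<close> are then the elements that are initial ordinals.
\<close>

definition cardinals_below :: "'k rel \<Rightarrow> 'k set" where
  "cardinals_below \<kappa> = {x \<in> Field \<kappa>. Card_order (Restr \<kappa> (underS \<kappa> x))}"

lemma ordLess_iff_cardinals_below: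
  fixes \<kappa> :: "'k rel" and \<mu> :: "'m rel"
  assumes "Card_order \<kappa>" and "Card_order \<mu>"
  shows "\<mu> <o \<kappa> \<longleftrightarrow> (\<exists>x \<in> cardinals_below \<kappa>. \<mu> =o Restr \<kappa> (underS \<kappa> x))"
proof -
  have "Well_order \<kappa>" "Well_order \<mu>"
    using assms card_order_on_well_order_on by blast+
  then have "\<mu> <o \<kappa> \<longleftrightarrow> (\<exists>x \<in> Field \<kappa>. \<mu> =o Restr \<kappa> (underS \<kappa> x))"
    by (rule ordLess_iff_ordIso_Restr)
  then show ?thesis
    using Card_order_ordIso2[OF assms(2)] by (auto simp: cardinals_below_def)
qed

text \<open>
  Every cardinal below \<open>\<Lambda>\<close> has a representative over the type of \<open>\<Lambda>\<close>, so quantifying over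
  relations on that type is no restriction.
\<close>

definition strong_limit :: "'l rel \<Rightarrow> bool" where
  "strong_limit \<Lambda> \<longleftrightarrow>
     Card_order \<Lambda> \<and> (\<forall>\<mu> :: 'l rel. Card_order \<mu> \<longrightarrow> \<mu> <o \<Lambda> \<longrightarrow> ctwo ^c \<mu> <o \<Lambda>)"

lemma strong_limit_any_type:
  fixes \<Lambda> :: "'l rel" and \<mu> :: "'m rel"
  assumes "strong_limit \<Lambda>" and "Card_order \<mu>" and "\<mu> <o \<Lambda>"
  shows "ctwo ^c \<mu> <o \<Lambda>"
proof -
  obtain x where x: "x \<in> cardinals_below \<Lambda>" and iso: "\<mu> =o Restr \<Lambda> (underS \<Lambda> x)"
    using assms ordLess_iff_cardinals_below[of \<Lambda> \<mu>] unfolding strong_limit_def by blast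
  let ?\<nu> = "Restr \<Lambda> (underS \<Lambda> x)"
  have "Card_order ?\<nu>" using x by (simp add: cardinals_below_def)
  moreover have "?\<nu> <o \<Lambda>" using iso assms(3) by (metis ordIso_ordLess_trans ordIso_symmetric)
  ultimately have "ctwo ^c ?\<nu> <o \<Lambda>" using assms(1) by (simp add: strong_limit_def)
  moreover have "ctwo ^c \<mu> =o ctwo ^c ?\<nu>"
    by (rule cexp_cong2[OF iso Card_order_ctwo assms(2)])
  ultimately show ?thesis by (rule ordIso_ordLess_trans[rotated])
qed

definition tuples :: "'a set \<Rightarrow> 'k rel \<Rightarrow> 'k \<Rightarrow> ('k \<Rightarrow> 'a) set" where
  "tuples A \<kappa> n = (underS \<kappa> n \<rightarrow>\<^sub>E A)"

text \<open>
  Operations and relations carry their arity as first component: extensional functions in HOL do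
  not determine their domain, and the empty relation does not determine its arity.
\<close>

definition operations :: "'a set \<Rightarrow> 'l rel \<Rightarrow> ('l \<times> (('l \<Rightarrow> 'a) \<Rightarrow> 'a)) set" where
  "operations A \<Lambda> = (SIGMA n : cardinals_below \<Lambda>. tuples A \<Lambda> n \<rightarrow>\<^sub>E A)"

definition relations :: "'a set \<Rightarrow> 'k rel \<Rightarrow> ('k \<times> ('k \<Rightarrow> 'a) set) set" where
  "relations A \<kappa> = (SIGMA m : cardinals_below \<kappa>. Pow (tuples A \<kappa> m))"

definition operational_clone :: "'a set \<Rightarrow> 'l rel \<Rightarrow> ('l \<times> (('l \<Rightarrow> 'a) \<Rightarrow> 'a)) set \<Rightarrow> bool" where
  "operational_clone A \<Lambda> C \<longleftrightarrow>
     C \<subseteq> operations A \<Lambda> \<and>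
     (\<forall>n \<in> cardinals_below \<Lambda>. \<forall>i \<in> underS \<Lambda> n. (n, \<lambda>a \<in> tuples A \<Lambda> n. a i) \<in> C) \<and>
     (\<forall>n \<in> cardinals_below \<Lambda>. \<forall>(m, f) \<in> C. \<forall>g.
        (\<forall>i \<in> underS \<Lambda> m. (n, g i) \<in> C) \<longrightarrow>
        (n, \<lambda>a \<in> tuples A \<Lambda> n. f (\<lambda>i \<in> underS \<Lambda> m. g i a)) \<in> C)"

text \<open>
  The \<open>m\<close>-ary relation defined by a primitive positive formula: \<open>Inl j\<close> is the \<open>j\<close>-th free
  variable, \<open>Inr t\<close> with \<^term>\<open>t \<in> Field \<tau>\<close> is an existentially quantified variable, every
  \<^term>\<open>u \<in> U\<close> is an atom with relation \<^term>\<open>\<rho> (g u)\<close> and variables \<^term>\<open>\<lambda>j. f (u, j)\<close>, and every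
  \<^term>\<open>(x, y) \<in> E\<close> is an equation between variables. Equality is a logical symbol of
  \<open>L\<^bsub>\<infinity>,\<infinity>\<^esub>\<close>; it cannot be dropped, as the full relations alone are closed under
  equation-free formulas, while the equality relation is invariant under all operations.
\<close>

definition pp_relation ::
  "'a set \<Rightarrow> 'k rel \<Rightarrow> 'k \<Rightarrow> 't rel \<Rightarrow> ('i \<Rightarrow> 'k \<times> ('k \<Rightarrow> 'a) set) \<Rightarrow> 'u set \<Rightarrow> ('u \<Rightarrow> 'i) \<Rightarrow>
   ('u \<times> 'k \<Rightarrow> 'k + 't) \<Rightarrow> (('k + 't) \<times> ('k + 't)) set \<Rightarrow> ('k \<Rightarrow> 'a) set" where
  "pp_relation A \<kappa> m \<tau> \<rho> U g f E =
     {a \<in> tuples A \<kappa> m. \<exists>b \<in> Field \<tau> \<rightarrow>\<^sub>E A.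
        (\<forall>u \<in> U. (\<lambda>j \<in> underS \<kappa> (fst (\<rho> (g u))). case_sum a b (f (u, j))) \<in> snd (\<rho> (g u))) \<and>
        (\<forall>(x, y) \<in> E. case_sum a b x = case_sum a b y)}"

definition pp_closed ::
  "'i itself \<Rightarrow> 'u itself \<Rightarrow> 't itself \<Rightarrow> 'a set \<Rightarrow> 'k rel \<Rightarrow> ('k \<times> ('k \<Rightarrow> 'a) set) set \<Rightarrow> bool" where
  "pp_closed _ _ _ A \<kappa> R \<longleftrightarrow>
     (\<forall>(K :: 'i set) \<rho> m (\<tau> :: 't rel) (U :: 'u set) g f E.
        \<rho> \<in> K \<rightarrow> R \<longrightarrow> m \<in> cardinals_below \<kappa> \<longrightarrow> Card_order \<tau> \<longrightarrow> g \<in> U \<rightarrow> K \<longrightarrow>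
        f \<in> (SIGMA u : U. underS \<kappa> (fst (\<rho> (g u)))) \<rightarrow> underS \<kappa> m <+> Field \<tau> \<longrightarrow>
        E \<subseteq> (underS \<kappa> m <+> Field \<tau>) \<times> (underS \<kappa> m <+> Field \<tau>) \<longrightarrow>
        (m, pp_relation A \<kappa> m \<tau> \<rho> U g f E) \<in> R)"

text \<open>
  The index sets \<open>K\<close>, \<open>U\<close> and the cardinal \<open>\<tau>\<close> are unbounded in a primitive positive formula, but
  HOL cannot quantify over types. The types below are large enough for closure under formulas
  over arbitrary types, see \<open>relational_clone_any_type\<close>.
\<close>

definition relational_clone :: "'a set \<Rightarrow> 'k rel \<Rightarrow> ('k \<times> ('k \<Rightarrow> 'a) set) set \<Rightarrow> bool" where
  "relational_clone A \<kappa> R \<longleftrightarrow>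
     R \<subseteq> relations A \<kappa> \<and>
     pp_closed TYPE('k \<times> ('k \<Rightarrow> 'a) set)
       TYPE(('k \<times> ('k \<Rightarrow> 'a) set) \<times> ('k \<Rightarrow> 'k + (('k \<Rightarrow> 'a) \<Rightarrow> 'a)))
       TYPE(('k \<Rightarrow> 'a) \<Rightarrow> 'a) A \<kappa> R"

lemma relational_clone_any_type:
  fixes A :: "'a set" and \<kappa> :: "'k rel"
  assumes R: "relational_clone A \<kappa> R"
  shows "pp_closed TYPE('i) TYPE('u) TYPE('t) A \<kappa> R"
  unfolding pp_closed_def
proof (intro allI impI)
  fix K :: "'i set" and \<rho> m and \<tau> :: "'t rel" and U :: "'u set" and g f E
  assume \<rho>: "\<rho> \<in> K \<rightarrow> R" and m: "m \<in> cardinals_below \<kappa>" and "Card_order \<tau>" and g: "g \<in> U \<rightarrow> K"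
    and f: "f \<in> (SIGMA u : U. underS \<kappa> (fst (\<rho> (g u)))) \<rightarrow> underS \<kappa> m <+> Field \<tau>"
    and E: "E \<subseteq> (underS \<kappa> m <+> Field \<tau>) \<times> (underS \<kappa> m <+> Field \<tau>)"
  define P where "P = pp_relation A \<kappa> m \<tau> \<rho> U g f E"
  define sat where "sat a b \<longleftrightarrow>
      (\<forall>u \<in> U. (\<lambda>j \<in> underS \<kappa> (fst (\<rho> (g u))). case_sum a b (f (u, j))) \<in> snd (\<rho> (g u))) \<and>
      (\<forall>(x, y) \<in> E. case_sum a b x = case_sum a b y)" for a and b :: "'t \<Rightarrow> 'a"
  have P: "a \<in> P \<longleftrightarrow> a \<in> tuples A \<kappa> m \<and> (\<exists>b \<in> Field \<tau> \<rightarrow>\<^sub>E A. sat a b)" for a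
    by (simp add: P_def pp_relation_def sat_def)
  then obtain w where w: "\<And>a. a \<in> P \<Longrightarrow> w a \<in> Field \<tau> \<rightarrow>\<^sub>E A \<and> sat a (w a)"
    by metis
  \<comment> \<open>quantified variables with the same values under all witnesses can be identified\<close>
  define col where "col t = (\<lambda>a. w a t)" for t
  define \<tau>' where "\<tau>' = |col ` Field \<tau>|"
  have F\<tau>': "Field \<tau>' = col ` Field \<tau>" by (simp add: \<tau>'_def Field_card_of)
  define h where "h u = (\<rho> (g u), \<lambda>j. map_sum id col (f (u, j)))" for u
  define U' where "U' = h ` U"
  define f' where "f' = (\<lambda>(u' :: ('k \<times> ('k \<Rightarrow> 'a) set) \<times> ('k \<Rightarrow> 'k + (('k \<Rightarrow> 'a) \<Rightarrow> 'a)), j). snd u' j)"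
  define E' where "E' = map_prod (map_sum id col) (map_sum id col) ` E"
  have ms: "map_sum id col x \<in> underS \<kappa> m <+> Field \<tau>'" if "x \<in> underS \<kappa> m <+> Field \<tau>" for x
    using that by (auto simp: F\<tau>')
  have "(m, pp_relation A \<kappa> m \<tau>' id U' fst f' E') \<in> R"
  proof -
    have "id \<in> R \<rightarrow> R" "Card_order \<tau>'"
      by (auto simp: \<tau>'_def card_of_Card_order)
    moreover have "fst \<in> U' \<rightarrow> R" using \<rho> g by (auto simp: U'_def h_def)
    moreover have
      "f' \<in> (SIGMA u : U'. underS \<kappa> (fst (id (fst u)))) \<rightarrow> underS \<kappa> m <+> Field \<tau>'"
    proof
      fix p assume "p \<in> (SIGMA u : U'. underS \<kappa> (fst (id (fst u))))"
      then obtain u j where "u \<in> U" "p = (h u, j)" "j \<in> underS \<kappa> (fst (\<rho> (g u)))"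
        by (auto simp: U'_def h_def)
      moreover from this have "f (u, j) \<in> underS \<kappa> m <+> Field \<tau>" using f by auto
      ultimately show "f' p \<in> underS \<kappa> m <+> Field \<tau>'"
        using ms by (simp add: f'_def h_def)
    qed
    moreover have "E' \<subseteq> (underS \<kappa> m <+> Field \<tau>') \<times> (underS \<kappa> m <+> Field \<tau>')"
      unfolding E'_def
    proof
      fix p assume "p \<in> map_prod (map_sum id col) (map_sum id col) ` E"
      then obtain x y where "(x, y) \<in> E" "p = (map_sum id col x, map_sum id col y)" by auto
      then show "p \<in> (underS \<kappa> m <+> Field \<tau>') \<times> (underS \<kappa> m <+> Field \<tau>')"
        using E ms by blast
    qed
    ultimately show ?thesis
      using R m unfolding relational_clone_def pp_closed_def by blast
  qed
  moreover have "pp_relation A \<kappa> m \<tau>' id U' fst f' E' = P"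
  proof -
    define sat' where "sat' a b \<longleftrightarrow>
        (\<forall>u \<in> U'. (\<lambda>j \<in> underS \<kappa> (fst (id (fst u))). case_sum a b (f' (u, j))) \<in> snd (id (fst u))) \<and>
        (\<forall>(x, y) \<in> E'. case_sum a b x = case_sum a b y)" for a b
    have cs: "case_sum a b (map_sum id col x) = case_sum a (b \<circ> col) x"
      for a :: "'k \<Rightarrow> 'a" and b x by (cases x) auto
    have sat': "sat' a b \<longleftrightarrow> sat a (b \<circ> col)" for a b
      by (auto simp: sat'_def sat_def U'_def E'_def h_def f'_def cs split_beta)
    have cong: "sat a b \<longleftrightarrow> sat a c" if eq: "\<And>t. t \<in> Field \<tau> \<Longrightarrow> b t = c t" for a b c
    proof -
      have v: "case_sum a b x = case_sum a c x" if "x \<in> underS \<kappa> m <+> Field \<tau>" for x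
        using that eq by auto
      have 1: "(\<lambda>j \<in> underS \<kappa> (fst (\<rho> (g u))). case_sum a b (f (u, j))) =
               (\<lambda>j \<in> underS \<kappa> (fst (\<rho> (g u))). case_sum a c (f (u, j)))" if "u \<in> U" for u
      proof (rule restrict_ext)
        fix j assume "j \<in> underS \<kappa> (fst (\<rho> (g u)))"
        then have "f (u, j) \<in> underS \<kappa> m <+> Field \<tau>" using f that by auto
        then show "case_sum a b (f (u, j)) = case_sum a c (f (u, j))" by (rule v)
      qed
      have 2: "case_sum a b x = case_sum a c x \<and> case_sum a b y = case_sum a c y"
        if "(x, y) \<in> E" for x y
        using that E v by blast
      have "(\<forall>(x, y) \<in> E. case_sum a b x = case_sum a b y) \<longleftrightarrow>
            (\<forall>(x, y) \<in> E. case_sum a c x = case_sum a c y)"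
        using 2 by (intro ball_cong) auto
      then show ?thesis by (simp add: sat_def 1)
    qed
    have "(\<exists>b \<in> Field \<tau>' \<rightarrow>\<^sub>E A. sat' a b) \<longleftrightarrow> a \<in> P" if a: "a \<in> tuples A \<kappa> m" for a
    proof
      assume "\<exists>b \<in> Field \<tau>' \<rightarrow>\<^sub>E A. sat' a b"
      then obtain b where b: "b \<in> Field \<tau>' \<rightarrow>\<^sub>E A" "sat a (b \<circ> col)" using sat' by auto
      then have "sat a (restrict (b \<circ> col) (Field \<tau>))"
        using cong[of "restrict (b \<circ> col) (Field \<tau>)" "b \<circ> col" a] by simp
      moreover have "restrict (b \<circ> col) (Field \<tau>) \<in> Field \<tau> \<rightarrow>\<^sub>E A"
        using b(1) by (auto simp: F\<tau>')
      ultimately show "a \<in> P" using a P by blast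
    next
      assume "a \<in> P"
      note wa = w[OF this]
      let ?b = "restrict (\<lambda>c. c a) (Field \<tau>')"
      have "?b \<in> Field \<tau>' \<rightarrow>\<^sub>E A" using wa by (auto simp: F\<tau>' col_def)
      moreover have "sat a (?b \<circ> col)"
        using wa cong[of "?b \<circ> col" "w a" a] by (auto simp: F\<tau>' col_def)
      ultimately show "\<exists>b \<in> Field \<tau>' \<rightarrow>\<^sub>E A. sat' a b" using sat' by blast
    qed
    moreover have "pp_relation A \<kappa> m \<tau>' id U' fst f' E' =
        {a \<in> tuples A \<kappa> m. \<exists>b \<in> Field \<tau>' \<rightarrow>\<^sub>E A. sat' a b}"
      unfolding pp_relation_def sat'_def ..
    ultimately show ?thesis using P by blast
  qed
  ultimately show "(m, pp_relation A \<kappa> m \<tau> \<rho> U g f E) \<in> R" by (simp add: P_def)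
qed

definition preserves ::
  "'l rel \<Rightarrow> 'k rel \<Rightarrow> 'l \<times> (('l \<Rightarrow> 'a) \<Rightarrow> 'a) \<Rightarrow> 'k \<times> ('k \<Rightarrow> 'a) set \<Rightarrow> bool" where
  "preserves \<Lambda> \<kappa> = (\<lambda>(n, f) (m, r).
     \<forall>a :: 'l \<Rightarrow> 'k \<Rightarrow> 'a. (\<forall>i \<in> underS \<Lambda> n. a i \<in> r) \<longrightarrow>
       (\<lambda>j \<in> underS \<kappa> m. f (\<lambda>i \<in> underS \<Lambda> n. a i j)) \<in> r)"

text \<open>\<open>Inv\<close> and \<open>Pol\<close> are for a fixed arity below \<open>\<kappa>\<close> and \<open>\<Lambda>\<close>, respectively.\<close>

definition Inv :: "'a set \<Rightarrow> 'l rel \<Rightarrow> 'k rel \<Rightarrow> 'k \<Rightarrow> ('l \<times> (('l \<Rightarrow> 'a) \<Rightarrow> 'a)) set \<Rightarrow>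
    ('k \<times> ('k \<Rightarrow> 'a) set) set" where
  "Inv A \<Lambda> \<kappa> m F = {(m, r) | r. r \<subseteq> tuples A \<kappa> m \<and> (\<forall>f \<in> F. preserves \<Lambda> \<kappa> f (m, r))}"

definition Inv_less :: "'a set \<Rightarrow> 'l rel \<Rightarrow> 'k rel \<Rightarrow> ('l \<times> (('l \<Rightarrow> 'a) \<Rightarrow> 'a)) set \<Rightarrow>
    ('k \<times> ('k \<Rightarrow> 'a) set) set" where
  "Inv_less A \<Lambda> \<kappa> F = (\<Union>m \<in> cardinals_below \<kappa>. Inv A \<Lambda> \<kappa> m F)"

definition Pol :: "'a set \<Rightarrow> 'l rel \<Rightarrow> 'k rel \<Rightarrow> 'l \<Rightarrow> ('k \<times> ('k \<Rightarrow> 'a) set) set \<Rightarrow>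
    ('l \<times> (('l \<Rightarrow> 'a) \<Rightarrow> 'a)) set" where
  "Pol A \<Lambda> \<kappa> n R = {(n, f) | f. f \<in> tuples A \<Lambda> n \<rightarrow>\<^sub>E A \<and> (\<forall>r \<in> R. preserves \<Lambda> \<kappa> (n, f) r)}"

definition Pol_less :: "'a set \<Rightarrow> 'l rel \<Rightarrow> 'k rel \<Rightarrow> ('k \<times> ('k \<Rightarrow> 'a) set) set \<Rightarrow>
    ('l \<times> (('l \<Rightarrow> 'a) \<Rightarrow> 'a)) set" where
  "Pol_less A \<Lambda> \<kappa> R = (\<Union>n \<in> cardinals_below \<Lambda>. Pol A \<Lambda> \<kappa> n R)"

end

theory Submission
  imports Defs
begin

text \<open>
  Part (1): the operations of arity \<open>n\<close> in a clone \<open>C\<close> form an invariant relation whose coordinates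
  are the tuples in \<open>A\<^sup>n\<close>. A polymorphism \<open>f\<close> of arity \<open>n\<close> maps the projections, which
  belong to this relation, to \<open>f\<close> itself, so \<open>f\<close> belongs to \<open>C\<close>.

  Part (2): list an invariant relation \<open>r\<close> of \<open>Pol R\<close> as a family \<open>(a\<^sub>i)\<close> of length \<open>n\<close>. Then \<open>r\<close>
  consists of the tuples \<open>f((a\<^sub>i)\<^sub>i)\<close> for \<open>n\<close>-ary polymorphisms \<open>f\<close>, and being such a polymorphism is
  a conjunction of atoms over \<open>R\<close> in variables indexed by \<open>A\<^sup>n\<close>.

  The strong limit hypothesis makes \<open>A\<^sup>n\<close>, in the first part, and \<open>r\<close>, in the second, smaller
  than \<open>\<Lambda>\<close>.
\<close>

section \<open>Cardinal arithmetic below a strong limit\<close>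

lemma strong_limit_Pow:
  assumes "strong_limit \<Lambda>" and "|X| <o \<Lambda>"
  shows "|Pow X| <o \<Lambda>"
proof -
  have "|Pow X| =o ctwo ^c |X|"
    using card_of_Pow_Func[of X] by (simp add: cexp_def ctwo_def Field_card_of)
  moreover have "ctwo ^c |X| <o \<Lambda>"
    using assms card_of_Card_order by (intro strong_limit_any_type)
  ultimately show ?thesis by (rule ordIso_ordLess_trans)
qed

text \<open>Kuratowski pairs embed \<open>X \<times> X\<close> into the double power set, also when \<open>X\<close> is finite.\<close>

lemma strong_limit_Times_self:
  assumes "strong_limit \<Lambda>" and "|X| <o \<Lambda>"
  shows "|X \<times> X| <o \<Lambda>"
proof -
  have "inj_on (\<lambda>(x, y). {{x}, {x, y}}) (X \<times> X)"
  proof (rule inj_onI, clarify)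
    fix x y x' y' assume eq: "{{x}, {x, y}} = {{x'}, {x', y'}}"
    then have "x = x'" by (metis doubleton_eq_iff insert_absorb2)
    with eq show "x = x' \<and> y = y'" by (metis doubleton_eq_iff)
  qed
  moreover have "(\<lambda>(x, y). {{x}, {x, y}}) p \<in> Pow (Pow X)" if "p \<in> X \<times> X" for p
    using that by auto
  ultimately have "|X \<times> X| \<le>o |Pow (Pow X)|" by (rule card_of_ordLeqI)
  moreover have "|Pow (Pow X)| <o \<Lambda>"
    using assms by (intro strong_limit_Pow)
  ultimately show ?thesis by (rule ordLeq_ordLess_trans)
qed

text \<open>The product embeds into the square of the larger factor.\<close>

lemma strong_limit_Times:
  assumes \<Lambda>: "strong_limit \<Lambda>" and X: "|X| <o \<Lambda>" and Y: "|Y| <o \<Lambda>"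
  shows "|X \<times> Y| <o \<Lambda>"
proof -
  have "|X| \<le>o |Y| \<or> |Y| \<le>o |X|"
    by (intro ordLeq_total card_of_Well_order)
  then show ?thesis
  proof
    assume "|X| \<le>o |Y|"
    then have "|X \<times> Y| \<le>o |Y \<times> Y|" by (rule card_of_Times_mono1)
    then show ?thesis using strong_limit_Times_self[OF \<Lambda> Y] by (rule ordLeq_ordLess_trans)
  next
    assume "|Y| \<le>o |X|"
    then have "|X \<times> Y| \<le>o |X \<times> X|" by (rule card_of_Times_mono2)
    then show ?thesis using strong_limit_Times_self[OF \<Lambda> X] by (rule ordLeq_ordLess_trans)
  qed
qed

text \<open>An extensional function is determined by its graph over \<open>X\<close>, a subset of
  \<open>X \<times> Y\<close>.\<close>

lemma strong_limit_PiE: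
  assumes "strong_limit \<Lambda>" and "|X| <o \<Lambda>" and "|Y| <o \<Lambda>"
  shows "|X \<rightarrow>\<^sub>E Y| <o \<Lambda>"
proof -
  let ?graph = "\<lambda>f. (\<lambda>x. (x, f x)) ` X"
  have "inj_on ?graph (X \<rightarrow>\<^sub>E Y)"
  proof (rule inj_onI)
    fix f g assume fg: "f \<in> X \<rightarrow>\<^sub>E Y" "g \<in> X \<rightarrow>\<^sub>E Y" and eq: "?graph f = ?graph g"
    from fg show "f = g"
    proof (rule PiE_ext)
      fix x assume "x \<in> X"
      then have "(x, f x) \<in> ?graph g" unfolding eq[symmetric] by blast
      then show "f x = g x" by auto
    qed
  qed
  moreover have "?graph f \<in> Pow (X \<times> Y)" if "f \<in> X \<rightarrow>\<^sub>E Y" for f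
    using that by auto
  ultimately have "|X \<rightarrow>\<^sub>E Y| \<le>o |Pow (X \<times> Y)|" by (rule card_of_ordLeqI)
  moreover have "|Pow (X \<times> Y)| <o \<Lambda>"
    using assms by (intro strong_limit_Pow strong_limit_Times)
  ultimately show ?thesis by (rule ordLeq_ordLess_trans)
qed

lemma card_of_underS_less:
  assumes "Card_order \<Lambda>" and "n \<in> cardinals_below \<Lambda>"
  shows "|underS \<Lambda> n| <o \<Lambda>"
  using assms by (simp add: cardinals_below_def card_of_underS)

text \<open>Turns a size bound into an arity: arities are elements of \<open>\<Lambda>\<close>, so a
  set of coordinates or arguments has to be listed along some
  \<open>underS \<Lambda> n\<close>.\<close>

lemma enumerate_below:
  fixes \<Lambda> :: "'l rel" and X :: "'x set"
  assumes "Card_order \<Lambda>" and "|X| <o \<Lambda>"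
  obtains n e where "n \<in> cardinals_below \<Lambda>" and "bij_betw e (underS \<Lambda> n) X"
proof -
  obtain n where n: "n \<in> cardinals_below \<Lambda>" and iso: "|X| =o Restr \<Lambda> (underS \<Lambda> n)"
    using assms ordLess_iff_cardinals_below[OF assms(1) card_of_Card_order] by blast
  have "Well_order \<Lambda>" using assms(1) card_order_on_well_order_on by blast
  then have "Field (Restr \<Lambda> (underS \<Lambda> n)) = underS \<Lambda> n"
    by (simp add: Refl_Field_Restr2 Order_Relation.underS_Field order_on_defs)
  moreover obtain h where "bij_betw h X (Field (Restr \<Lambda> (underS \<Lambda> n)))"
    using iso unfolding ordIso_def iso_def by (auto simp: Field_card_of)
  ultimately have "bij_betw (inv_into X h) (underS \<Lambda> n) X"
    using bij_betw_inv_into by metis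
  with n show thesis by (rule that)
qed

lemma strong_limit_tuples:
  assumes "strong_limit \<Lambda>" and "|A| <o \<Lambda>" and "n \<in> cardinals_below \<Lambda>"
  shows "|tuples A \<Lambda> n| <o \<Lambda>"
  using assms card_of_underS_less unfolding tuples_def
  by (intro strong_limit_PiE) (auto simp: strong_limit_def)

section \<open>Galois connection between operations and relations: the easy inclusions\<close>

lemma clone_subset_Pol_Inv:
  assumes "C \<subseteq> operations A \<Lambda>"
  shows "C \<subseteq> Pol_less A \<Lambda> \<kappa> (Inv_less A \<Lambda> \<kappa> C)"
  using assms by (fastforce simp: operations_def Pol_less_def Pol_def Inv_less_def Inv_def)

lemma rels_subset_Inv_Pol:
  assumes "R \<subseteq> relations A \<kappa>"
  shows "R \<subseteq> Inv_less A \<Lambda> \<kappa> (Pol_less A \<Lambda> \<kappa> R)"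
  using assms by (fastforce simp: relations_def Pol_less_def Pol_def Inv_less_def Inv_def)

section \<open>Operational clones\<close>

lemma Pol_Inv_subset_clone:
  fixes \<Lambda> :: "'l rel"
  assumes \<Lambda>: "strong_limit \<Lambda>" and A: "|A| <o \<Lambda>" and C: "operational_clone A \<Lambda> C"
  shows "Pol_less A \<Lambda> \<Lambda> (Inv_less A \<Lambda> \<Lambda> C) \<subseteq> C"
proof clarify
  fix n f assume "(n, f) \<in> Pol_less A \<Lambda> \<Lambda> (Inv_less A \<Lambda> \<Lambda> C)"
  then have n: "n \<in> cardinals_below \<Lambda>" and f: "f \<in> tuples A \<Lambda> n \<rightarrow>\<^sub>E A"
    and pol: "\<And>r. r \<in> Inv_less A \<Lambda> \<Lambda> C \<Longrightarrow> preserves \<Lambda> \<Lambda> (n, f) r"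
    by (auto simp: Pol_less_def Pol_def)
  have op: "g \<in> tuples A \<Lambda> k \<rightarrow>\<^sub>E A" if "(k, g) \<in> C" for k g
    using C that by (auto simp: operational_clone_def operations_def)
  have "Card_order \<Lambda>" using \<Lambda> by (simp add: strong_limit_def)
  from this strong_limit_tuples[OF \<Lambda> A n] obtain m e
    where m: "m \<in> cardinals_below \<Lambda>" and e: "bij_betw e (underS \<Lambda> m) (tuples A \<Lambda> n)"
    by (rule enumerate_below)
  have e_in: "e j \<in> tuples A \<Lambda> n" if "j \<in> underS \<Lambda> m" for j
    using e that by (rule bij_betw_apply)
  \<comment> \<open>\<open>row g\<close> is the value table of \<open>g\<close>, with the arguments
    listed by \<open>e\<close>; thus \<open>r\<close> is the \<open>n\<close>-ary part of
    \<open>C\<close> written as an \<open>m\<close>-ary relation.\<close>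
  define row where "row g = (\<lambda>j \<in> underS \<Lambda> m. g (e j))" for g :: "('l \<Rightarrow> 'a) \<Rightarrow> 'a"
  define r where "r = row ` {g. (n, g) \<in> C}"
  have "(m, r) \<in> Inv_less A \<Lambda> \<Lambda> C"
  proof -
    have "row g \<in> tuples A \<Lambda> m" if "(n, g) \<in> C" for g
      using op[OF that] e_in by (auto simp: row_def tuples_def[of A \<Lambda> m])
    then have "r \<subseteq> tuples A \<Lambda> m" by (auto simp: r_def)
    moreover have "preserves \<Lambda> \<Lambda> (k, h) (m, r)" if h: "(k, h) \<in> C" for k h
      unfolding preserves_def prod.case
    proof (intro allI impI)
      fix a :: "'l \<Rightarrow> 'l \<Rightarrow> 'a" assume "\<forall>i \<in> underS \<Lambda> k. a i \<in> r"
      then have "\<forall>i \<in> underS \<Lambda> k. \<exists>g. (n, g) \<in> C \<and> a i = row g" by (auto simp: r_def)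
      then obtain g where g: "\<And>i. i \<in> underS \<Lambda> k \<Longrightarrow> (n, g i) \<in> C \<and> a i = row (g i)"
        by metis
      \<comment> \<open>Applying \<open>h\<close> coordinatewise to the tables of the
        \<open>g i\<close> yields the table of this composition.\<close>
      let ?hg = "\<lambda>x \<in> tuples A \<Lambda> n. h (\<lambda>i \<in> underS \<Lambda> k. g i x)"
      have "(n, ?hg) \<in> C"
        using C n h g unfolding operational_clone_def by fast
      moreover have "(\<lambda>j \<in> underS \<Lambda> m. h (\<lambda>i \<in> underS \<Lambda> k. a i j)) = row ?hg"
        unfolding row_def
      proof (rule restrict_ext)
        fix j assume j: "j \<in> underS \<Lambda> m"
        then have "(\<lambda>i \<in> underS \<Lambda> k. a i j) = (\<lambda>i \<in> underS \<Lambda> k. g i (e j))"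
          using g by (intro restrict_ext) (simp add: row_def)
        then show "h (\<lambda>i \<in> underS \<Lambda> k. a i j) = ?hg (e j)" using e_in[OF j] by simp
      qed
      ultimately show "(\<lambda>j \<in> underS \<Lambda> m. h (\<lambda>i \<in> underS \<Lambda> k. a i j)) \<in> r"
        by (simp add: r_def)
    qed
    ultimately show ?thesis using m by (auto simp: Inv_less_def Inv_def)
  qed
  then have pres: "preserves \<Lambda> \<Lambda> (n, f) (m, r)" by (rule pol)
  \<comment> \<open>The tables of the projections: their \<open>j\<close>-th entries together form
    the tuple \<open>e j\<close>, so applying \<open>f\<close> to them gives the table of
    \<open>f\<close>.\<close>
  define p where "p i = row (\<lambda>x \<in> tuples A \<Lambda> n. x i)" for i
  have "p i \<in> r" if "i \<in> underS \<Lambda> n" for i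
    using C n that by (auto simp: r_def p_def operational_clone_def)
  then have "(\<lambda>j \<in> underS \<Lambda> m. f (\<lambda>i \<in> underS \<Lambda> n. p i j)) \<in> r"
    using pres by (simp add: preserves_def)
  moreover have "(\<lambda>j \<in> underS \<Lambda> m. f (\<lambda>i \<in> underS \<Lambda> n. p i j)) = row f"
    unfolding row_def
  proof (rule restrict_ext)
    fix j assume j: "j \<in> underS \<Lambda> m"
    then have "(\<lambda>i \<in> underS \<Lambda> n. p i j) = restrict (e j) (underS \<Lambda> n)"
      using e_in by (intro restrict_ext) (simp add: p_def row_def)
    also have "\<dots> = e j" using e_in[OF j] unfolding tuples_def by (rule PiE_restrict)
    finally show "f (\<lambda>i \<in> underS \<Lambda> n. p i j) = f (e j)" by simp
  qed
  ultimately obtain g where g: "(n, g) \<in> C" and eq: "row f = row g" by (auto simp: r_def)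
  \<comment> \<open>The enumeration \<open>e\<close> is onto, so equal tables mean equal values on
    all of \<open>tuples A \<Lambda> n\<close>.\<close>
  have "f = g"
    using f op[OF g]
  proof (rule PiE_ext)
    fix x assume "x \<in> tuples A \<Lambda> n"
    then obtain j where "j \<in> underS \<Lambda> m" "x = e j"
      using e by (auto simp: bij_betw_def)
    then show "f x = g x" using fun_cong[OF eq, of j] by (simp add: row_def)
  qed
  with g show "(n, f) \<in> C" by simp
qed

section \<open>Relational clones\<close>

lemma projection_in_Pol:
  assumes R: "R \<subseteq> relations A \<kappa>" and i: "i \<in> underS \<Lambda> n"
  shows "(n, \<lambda>x \<in> tuples A \<Lambda> n. x i) \<in> Pol A \<Lambda> \<kappa> n R"
proof -
  have "preserves \<Lambda> \<kappa> (n, \<lambda>x \<in> tuples A \<Lambda> n. x i) (k, s)" if "(k, s) \<in> R" for k s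
    unfolding preserves_def prod.case
  proof (intro allI impI)
    fix a assume a: "\<forall>i \<in> underS \<Lambda> n. a i \<in> s"
    have s: "s \<subseteq> underS \<kappa> k \<rightarrow>\<^sub>E A"
      using R that by (auto simp: relations_def tuples_def)
    \<comment> \<open>The projection is \<open>undefined\<close> outside
      \<open>tuples A \<Lambda> n\<close>, so each column of the family must be shown to lie there
      before it can be evaluated.\<close>
    then have "(\<lambda>i \<in> underS \<Lambda> n. a i j) \<in> tuples A \<Lambda> n" if "j \<in> underS \<kappa> k" for j
      using a that unfolding tuples_def by fastforce
    then have "(\<lambda>j \<in> underS \<kappa> k. (\<lambda>x \<in> tuples A \<Lambda> n. x i) (\<lambda>i \<in> underS \<Lambda> n. a i j)) =
        restrict (a i) (underS \<kappa> k)"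
      using i by (intro restrict_ext) simp
    also have "\<dots> = a i" using a i s by (intro PiE_restrict) blast
    finally show "(\<lambda>j \<in> underS \<kappa> k. (\<lambda>x \<in> tuples A \<Lambda> n. x i) (\<lambda>i \<in> underS \<Lambda> n. a i j)) \<in> s"
      using a i by simp
  qed
  moreover have "(\<lambda>x \<in> tuples A \<Lambda> n. x i) \<in> tuples A \<Lambda> n \<rightarrow>\<^sub>E A"
    using i by (auto simp: tuples_def)
  ultimately show ?thesis by (auto simp: Pol_def)
qed

text \<open>
  The quantified variables are the tuples in \<open>A\<^sup>n\<close>, so that a witness is an \<open>n\<close>-ary operation \<open>f\<close>;
  the atoms state that \<open>f\<close> is a polymorphism, and the equations that the \<open>j\<close>-th free variable is the
  value of \<open>f\<close> at \<open>(a\<^sub>i j)\<^sub>i\<close>.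
\<close>

lemma Pol_image_in_relational_clone:
  fixes A :: "'a set" and \<kappa> :: "'k rel" and \<Lambda> :: "'l rel"
  assumes R: "relational_clone A \<kappa> R" and m: "m \<in> cardinals_below \<kappa>"
    and a: "\<And>i. i \<in> underS \<Lambda> n \<Longrightarrow> a i \<in> tuples A \<kappa> m"
  shows "(m, {\<lambda>j \<in> underS \<kappa> m. f (\<lambda>i \<in> underS \<Lambda> n. a i j) | f. (n, f) \<in> Pol A \<Lambda> \<kappa> n R}) \<in> R"
    (is "(m, ?Q) \<in> R")
proof -
  have Rrel: "R \<subseteq> relations A \<kappa>" using R by (simp add: relational_clone_def)
  define col where "col b j = (\<lambda>i \<in> underS \<Lambda> n. b i j)" for b :: "'l \<Rightarrow> 'k \<Rightarrow> 'a" and j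
  define \<tau> where "\<tau> = |tuples A \<Lambda> n|"
  have F\<tau>: "Field \<tau> = tuples A \<Lambda> n" by (simp add: \<tau>_def Field_card_of)
  \<comment> \<open>One atom for each relation \<open>s\<close> in \<open>R\<close> and each family
    \<open>b\<close> of members of \<open>s\<close>. Its \<open>j\<close>-th place holds the
    variable \<open>col b j\<close>, whose value under a witness \<open>f\<close> is
    \<open>f\<close> applied to the \<open>j\<close>-th column of \<open>b\<close>.\<close>
  define U where "U = {(s, b :: 'l \<Rightarrow> 'k \<Rightarrow> 'a). s \<in> R \<and> (\<forall>i \<in> underS \<Lambda> n. b i \<in> snd s)}"
  define v where
    "v = (\<lambda>((s :: 'k \<times> ('k \<Rightarrow> 'a) set, b), j). Inr (col b j) :: 'k + ('l \<Rightarrow> 'a))"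
  define E where
    "E = (\<lambda>j. (Inl j :: 'k + ('l \<Rightarrow> 'a), Inr (col a j) :: 'k + ('l \<Rightarrow> 'a))) ` underS \<kappa> m"
  have col_in: "col b j \<in> tuples A \<Lambda> n"
    if "\<And>i. i \<in> underS \<Lambda> n \<Longrightarrow> b i \<in> tuples A \<kappa> k" "j \<in> underS \<kappa> k" for b j k
    using that by (auto simp: col_def tuples_def)
  have "id \<in> R \<rightarrow> R" "Card_order \<tau>" "fst \<in> U \<rightarrow> R"
    by (auto simp: \<tau>_def card_of_Card_order U_def)
  moreover have "v \<in> (SIGMA u : U. underS \<kappa> (fst (id (fst u)))) \<rightarrow> underS \<kappa> m <+> Field \<tau>"
  proof
    fix p assume "p \<in> (SIGMA u : U. underS \<kappa> (fst (id (fst u))))"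
    then obtain k s b j where p: "p = (((k, s), b), j)" and ks: "(k, s) \<in> R"
      and b: "\<forall>i \<in> underS \<Lambda> n. b i \<in> s" and j: "j \<in> underS \<kappa> k"
      by (auto simp: U_def)
    have "s \<subseteq> tuples A \<kappa> k" using ks Rrel by (auto simp: relations_def)
    then have "col b j \<in> tuples A \<Lambda> n" using b j by (intro col_in) auto
    then show "v p \<in> underS \<kappa> m <+> Field \<tau>" by (auto simp: p v_def F\<tau>)
  qed
  moreover have "E \<subseteq> (underS \<kappa> m <+> Field \<tau>) \<times> (underS \<kappa> m <+> Field \<tau>)"
    using col_in[OF a] by (auto simp: E_def F\<tau>)
  \<comment> \<open>The atoms and quantified variables range over types other than those fixed in
    \<open>relational_clone\<close>, hence the appeal to closure over arbitrary types.\<close>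
  ultimately have "(m, pp_relation A \<kappa> m \<tau> id U fst v E) \<in> R"
    using relational_clone_any_type[OF R] m unfolding pp_closed_def by blast
  moreover have "pp_relation A \<kappa> m \<tau> id U fst v E = ?Q"
  proof -
    have atoms: "(\<forall>u \<in> U. (\<lambda>j \<in> underS \<kappa> (fst (id (fst u))). case_sum c f (v (u, j))) \<in> snd (id (fst u)))
        \<longleftrightarrow> (\<forall>s \<in> R. preserves \<Lambda> \<kappa> (n, f) s)" for c f
      by (auto simp: U_def v_def col_def preserves_def)
    have eqns: "(\<forall>(x, y) \<in> E. case_sum c f x = case_sum c f y) \<longleftrightarrow>
        c = (\<lambda>j \<in> underS \<kappa> m. f (col a j))" if "c \<in> tuples A \<kappa> m" for c f
    proof -
      \<comment> \<open>The equations only fix \<open>c\<close> on \<open>underS \<kappa> m\<close>;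
        extensionality makes this an equality of functions.\<close>
      have "restrict c (underS \<kappa> m) = c"
        using that unfolding tuples_def by (rule PiE_restrict)
      moreover have "(\<forall>(x, y) \<in> E. case_sum c f x = case_sum c f y) \<longleftrightarrow>
          (\<forall>j \<in> underS \<kappa> m. c j = f (col a j))"
        by (simp add: E_def)
      moreover have "(\<forall>j \<in> underS \<kappa> m. c j = f (col a j)) \<longleftrightarrow>
          restrict c (underS \<kappa> m) = (\<lambda>j \<in> underS \<kappa> m. f (col a j))"
        by (auto simp: restrict_def fun_eq_iff)
      ultimately show ?thesis by simp
    qed
    have in_tuples: "(\<lambda>j \<in> underS \<kappa> m. f (col a j)) \<in> tuples A \<kappa> m"
      if "f \<in> tuples A \<Lambda> n \<rightarrow>\<^sub>E A" for f
      using that col_in[OF a] by (auto simp: tuples_def[of A \<kappa> m])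
    have "pp_relation A \<kappa> m \<tau> id U fst v E = {c \<in> tuples A \<kappa> m. \<exists>f \<in> tuples A \<Lambda> n \<rightarrow>\<^sub>E A.
        (\<forall>s \<in> R. preserves \<Lambda> \<kappa> (n, f) s) \<and> c = (\<lambda>j \<in> underS \<kappa> m. f (col a j))}"
      unfolding pp_relation_def F\<tau> atoms using eqns by blast
    also have "\<dots> = ?Q"
      unfolding Pol_def using in_tuples unfolding col_def by blast
    finally show ?thesis .
  qed
  ultimately show ?thesis by simp
qed

lemma Inv_Pol_subset_relational_clone:
  fixes \<Lambda> :: "'l rel"
  assumes \<Lambda>: "strong_limit \<Lambda>" and A: "|A| <o \<Lambda>" and R: "relational_clone A \<Lambda> R"
  shows "Inv_less A \<Lambda> \<Lambda> (Pol_less A \<Lambda> \<Lambda> R) \<subseteq> R"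
proof clarify
  fix m r assume "(m, r) \<in> Inv_less A \<Lambda> \<Lambda> (Pol_less A \<Lambda> \<Lambda> R)"
  then have m: "m \<in> cardinals_below \<Lambda>" and r: "r \<subseteq> tuples A \<Lambda> m"
    and inv: "\<And>f. f \<in> Pol_less A \<Lambda> \<Lambda> R \<Longrightarrow> preserves \<Lambda> \<Lambda> f (m, r)"
    by (auto simp: Inv_less_def Inv_def)
  have Rrel: "R \<subseteq> relations A \<Lambda>" using R by (simp add: relational_clone_def)
  have "Card_order \<Lambda>" using \<Lambda> by (simp add: strong_limit_def)
  \<comment> \<open>As a subset of \<open>tuples A \<Lambda> m\<close>, the relation
    \<open>r\<close> is small enough for its members to index the arguments of one
    operation.\<close>
  moreover have "|r| <o \<Lambda>"
    using card_of_mono1[OF r] strong_limit_tuples[OF \<Lambda> A m] by (rule ordLeq_ordLess_trans)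
  ultimately obtain n a where n: "n \<in> cardinals_below \<Lambda>" and a: "bij_betw a (underS \<Lambda> n) r"
    by (rule enumerate_below)
  have a_in: "a i \<in> r" if "i \<in> underS \<Lambda> n" for i
    using a that by (rule bij_betw_apply)
  let ?app = "\<lambda>f. \<lambda>j \<in> underS \<Lambda> m. f (\<lambda>i \<in> underS \<Lambda> n. a i j)"
  let ?Q = "{?app f | f. (n, f) \<in> Pol A \<Lambda> \<Lambda> n R}"
  have "(m, ?Q) \<in> R"
    using R m r a_in by (intro Pol_image_in_relational_clone) auto
  moreover have "?Q = r"
  proof
    show "?Q \<subseteq> r"
      using inv n a_in by (fastforce simp: Pol_less_def preserves_def)
    show "r \<subseteq> ?Q"
    proof
      fix c assume "c \<in> r"
      then obtain i where i: "i \<in> underS \<Lambda> n" and c: "c = a i"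
        using a by (auto simp: bij_betw_def)
      \<comment> \<open>The \<open>i\<close>-th projection is the polymorphism that recovers
        \<open>c = a i\<close> from the list; its arguments must first be seen to lie in its
        domain.\<close>
      have "(\<lambda>i \<in> underS \<Lambda> n. a i j) \<in> tuples A \<Lambda> n" if "j \<in> underS \<Lambda> m" for j
        using a_in r that unfolding tuples_def by fastforce
      then have "?app (\<lambda>x \<in> tuples A \<Lambda> n. x i) = restrict (a i) (underS \<Lambda> m)"
        using i by (intro restrict_ext) simp
      also have "\<dots> = c"
        unfolding c using a_in[OF i] r by (intro PiE_restrict) (auto simp: tuples_def)
      finally show "c \<in> ?Q" using projection_in_Pol[OF Rrel i] by blast
    qed
  qed
  ultimately show "(m, r) \<in> R" by simp
qed

theorem mainTheorem1:
  fixes A :: "'a set" and \<Lambda> :: "'l rel"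
  assumes "strong_limit \<Lambda>" and "|A| <o \<Lambda>"
  shows "(\<forall>C. operational_clone A \<Lambda> C \<longrightarrow> Pol_less A \<Lambda> \<Lambda> (Inv_less A \<Lambda> \<Lambda> C) = C) \<and>
    (\<forall>R. relational_clone A \<Lambda> R \<longrightarrow> Inv_less A \<Lambda> \<Lambda> (Pol_less A \<Lambda> \<Lambda> R) = R)"
proof (intro conjI allI impI)
  fix C assume C: "operational_clone A \<Lambda> C"
  then have "C \<subseteq> Pol_less A \<Lambda> \<Lambda> (Inv_less A \<Lambda> \<Lambda> C)"
    by (intro clone_subset_Pol_Inv) (simp add: operational_clone_def)
  with Pol_Inv_subset_clone[OF assms C] show "Pol_less A \<Lambda> \<Lambda> (Inv_less A \<Lambda> \<Lambda> C) = C"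
    by (rule subset_antisym)
next
  fix R assume R: "relational_clone A \<Lambda> R"
  then have "R \<subseteq> Inv_less A \<Lambda> \<Lambda> (Pol_less A \<Lambda> \<Lambda> R)"
    by (intro rels_subset_Inv_Pol) (simp add: relational_clone_def)
  with Inv_Pol_subset_relational_clone[OF assms R]
  show "Inv_less A \<Lambda> \<Lambda> (Pol_less A \<Lambda> \<Lambda> R) = R"
    by (rule subset_antisym)
qed

end
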